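(* (i) Any multiplicative linear functional $h$ on $(L^1(\mathbb{R}),\star_A)$ is of the form $$h(f)=\overline{\eta_A(\omega_0)}\,\mathcal{F}_A(f)(\omega_0),\qquad f\in L^1(\mathbb{R}),$$ for some $\omega_0\in\mathbb{R}$. (ii) Let $T:L^1(\mathbb{R})\to C_0(\mathbb{R})$ be a continuous linear operator satisfying $$T(f\star_Ag)(\omega)=\overline{\eta_A(\omega)}\,T(f)(\omega)\,T(g)(\omega)$$ for all $f,g\in L^1(\mathbb{R})$. Then there exist $E\subset\mathbb{R}$ and $\phi:\mathbb{R}\to\mathbb{R}$ such that $$T(f)(\omega)=\chi_E(\omega)\,\mathcal{F}_A(f)(\phi(\omega)),\qquad f\in L^1(\mathbb{R}).$$
   Context: $A=\{a,b,c,d,p,q\}$ are real parameters with $ad-bc=1$ and $b\neq0$. The special affine Fourier transform is $\mathcal{F}_Af(\omega)=\frac{1}{\sqrt{|b|}}\int_{\mathbb{R}}f(t)e^{\frac{\pi i}{b}(at^2+2pt-2\omega t+2(bq-dp)\omega+d\omega^2)}\,dt$ for $f\in L^1(\mathbb{R})$, and $\eta_A(\omega)=e^{\frac{\pi i}{b}(d\omega^2+2(bq-dp)\omega)}$. The $A$-convolution is $(f\star_Ag)(x)=\frac{1}{\sqrt{|b|}}\int_{\mathbb{R}}f(s)\,T_s^Ag(x)\,ds$ with $T_s^Ag(t)=e^{-\frac{2\pi i a}{b}s(t-s)}g(t-s)$. A linear functional $h$ on a Banach algebra is called multiplicative if $h(xy)=h(x)h(y)$ for all $x,y$; here the product is $\star_A$.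 $\chi_E$ is the indicator function of $E$, and $C_0(\mathbb{R})$ is the space of continuous functions vanishing at infinity.
   Formalization: In (i), h is assumed nonzero (h = 0 is multiplicative but not of the form). In (ii), the printed formula is false in general; the factor η_A(ω)·conj(η_A(φ(ω))) is inserted: T(f)(ω) = χ_E(ω) η_A(ω) conj(η_A(φ(ω))) F_A(f)(φ(ω)). *)

theory Defs
  imports "HOL-Analysis.Analysis"
begin

section \<open>The operators on functions\<close>

definition eta :: "real \<Rightarrow> real \<Rightarrow> real \<Rightarrow> real \<Rightarrow> real \<Rightarrow> complex" where
  "eta b d p q \<omega> = exp (of_real pi * \<i> / of_real b * of_real (d * \<omega>\<^sup>2 + 2 * (b * q - d * p) * \<omega>))"

text \<open>Pitfall: if \<open>T (f \<star> g) = cnj eta * T f * T g\<close> pointwise, then it is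
  \<open>f \<mapsto> cnj (eta \<omega>) * T f \<omega>\<close>, not \<open>f \<mapsto> T f \<omega>\<close>, that is multiplicative. Where this functional
  does not vanish it equals \<open>cnj (eta (\<phi> \<omega>)) * SAFT f (\<phi> \<omega>)\<close>, so \<open>T f \<omega>\<close> is \<open>SAFT f (\<phi> \<omega>)\<close> times
  the unimodular factor \<open>eta \<omega> * cnj (eta (\<phi> \<omega>))\<close>. If \<open>d\<close> and \<open>b * q - d * p\<close> are not both 0, it cannot be dropped:
  \<open>T f \<omega> = eta \<omega> * cnj (eta (2 * \<omega>)) * SAFT f (2 * \<omega>)\<close> is such an operator.\<close>

definition fun_SAFT ::
  "real \<Rightarrow> real \<Rightarrow> real \<Rightarrow> real \<Rightarrow> real \<Rightarrow> (real \<Rightarrow> complex) \<Rightarrow> real \<Rightarrow> complex" where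
  "fun_SAFT a b d p q f \<omega> = of_real (1 / sqrt \<bar>b\<bar>) *
     (\<integral>t. f t * exp (of_real pi * \<i> / of_real b *
        of_real (a * t\<^sup>2 + 2 * p * t - 2 * \<omega> * t + 2 * (b * q - d * p) * \<omega> + d * \<omega>\<^sup>2)) \<partial>lborel)"

definition A_translation :: "real \<Rightarrow> real \<Rightarrow> real \<Rightarrow> (real \<Rightarrow> complex) \<Rightarrow> real \<Rightarrow> complex" where
  "A_translation a b s g t =
     exp (- (2 * of_real pi * \<i> * of_real a / of_real b * of_real (s * (t - s)))) * g (t - s)"

definition fun_A_conv ::
  "real \<Rightarrow> real \<Rightarrow> (real \<Rightarrow> complex) \<Rightarrow> (real \<Rightarrow> complex) \<Rightarrow> real \<Rightarrow> complex" where
  "fun_A_conv a b f g x =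
     of_real (1 / sqrt \<bar>b\<bar>) * (\<integral>s. f s * A_translation a b s g x \<partial>lborel)"

section \<open>The complex Banach space of integrable functions modulo null sets\<close>

text \<open>Representatives are Borel measurable; as every Lebesgue measurable function agrees almost
  everywhere with a Borel measurable one, the quotient is the usual space.\<close>

definition L1_rel :: "(real \<Rightarrow> complex) \<Rightarrow> (real \<Rightarrow> complex) \<Rightarrow> bool" where
  "L1_rel f g \<longleftrightarrow> integrable lborel f \<and> integrable lborel g \<and> (AE x in lborel. f x = g x)"

quotient_type L1 = "real \<Rightarrow> complex" / partial: L1_rel
proof (rule part_equivpI)
  show "\<exists>f. L1_rel f f"
    by (intro exI[of _ "\<lambda>_. 0"]) (simp add: L1_rel_def)
  show "symp L1_rel"
    by (auto simp: symp_def L1_rel_def)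
  show "transp L1_rel"
    unfolding transp_def L1_rel_def by (auto elim: AE_mp)
qed

lift_definition L1_scaleC :: "complex \<Rightarrow> L1 \<Rightarrow> L1" is "\<lambda>k f x. k * f x"
  by (auto simp: L1_rel_def)

instantiation L1 :: real_normed_vector
begin

lift_definition zero_L1 :: L1 is "\<lambda>_. 0"
  by (simp add: L1_rel_def)

lift_definition plus_L1 :: "L1 \<Rightarrow> L1 \<Rightarrow> L1" is "\<lambda>f g x. f x + g x"
  by (auto simp: L1_rel_def)

lift_definition uminus_L1 :: "L1 \<Rightarrow> L1" is "\<lambda>f x. - f x"
  by (auto simp: L1_rel_def)

lift_definition minus_L1 :: "L1 \<Rightarrow> L1 \<Rightarrow> L1" is "\<lambda>f g x. f x - g x"
  by (auto simp: L1_rel_def)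

lift_definition scaleR_L1 :: "real \<Rightarrow> L1 \<Rightarrow> L1" is "\<lambda>r f x. r *\<^sub>R f x"
  by (auto simp: L1_rel_def)

lift_definition norm_L1 :: "L1 \<Rightarrow> real" is "\<lambda>f. \<integral>x. norm (f x) \<partial>lborel"
proof -
  fix f g assume "L1_rel f g"
  then have "integrable lborel f" "integrable lborel g" "AE x in lborel. f x = g x"
    by (simp_all add: L1_rel_def)
  then show "(\<integral>x. norm (f x) \<partial>lborel) = (\<integral>x. norm (g x) \<partial>lborel)"
    by (intro integral_cong_AE) auto
qed

definition dist_L1 :: "L1 \<Rightarrow> L1 \<Rightarrow> real" where
  "dist_L1 f g = norm (f - g)"

definition sgn_L1 :: "L1 \<Rightarrow> L1" where
  "sgn_L1 f = inverse (norm f) *\<^sub>R f"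

definition uniformity_L1 :: "(L1 \<times> L1) filter" where
  "uniformity_L1 = (INF e\<in>{0<..}. principal {(f, g). dist f g < e})"

definition open_L1 :: "L1 set \<Rightarrow> bool" where
  "open_L1 U \<longleftrightarrow> (\<forall>f\<in>U. eventually (\<lambda>(f', g). f' = f \<longrightarrow> g \<in> U) uniformity)"

instance
proof
  fix f g h :: L1 and r s :: real
  show "f + g + h = f + (g + h)" "f + g = g + f" "0 + f = f" "- f + f = 0" "f - g = f + - g"
    by (transfer; auto simp: L1_rel_def algebra_simps)+
  show "r *\<^sub>R (f + g) = r *\<^sub>R f + r *\<^sub>R g" "(r + s) *\<^sub>R f = r *\<^sub>R f + s *\<^sub>R f"
    "r *\<^sub>R s *\<^sub>R f = (r * s) *\<^sub>R f" "1 *\<^sub>R f = f"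
    by (transfer; auto simp: L1_rel_def algebra_simps)+
  show "(norm f = 0) = (f = 0)"
    by transfer (auto simp: L1_rel_def integral_nonneg_eq_0_iff_AE)
  show "norm (f + g) \<le> norm f + norm g"
  proof transfer
    fix f g assume "L1_rel f f" "L1_rel g g"
    then have fg: "integrable lborel f" "integrable lborel g"
      by (simp_all add: L1_rel_def)
    then have "(\<integral>x. norm (f x + g x) \<partial>lborel) \<le> (\<integral>x. norm (f x) + norm (g x) \<partial>lborel)"
      by (intro integral_mono norm_triangle_ineq) simp_all
    with fg show "(\<integral>x. norm (f x + g x) \<partial>lborel) \<le> (\<integral>x. norm (f x) \<partial>lborel) + (\<integral>x. norm (g x) \<partial>lborel)"
      by simp
  qed
  show "norm (r *\<^sub>R f) = \<bar>r\<bar> * norm f"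
    by transfer (auto simp: L1_rel_def)
qed (rule dist_L1_def sgn_L1_def uniformity_L1_def open_L1_def)+

end

interpretation L1: vector_space L1_scaleC
  by standard (transfer; auto simp: L1_rel_def algebra_simps)+

lemma norm_L1_scaleC: "norm (L1_scaleC k f) = norm k * norm f"
  by transfer (auto simp: L1_rel_def norm_mult)

lift_definition SAFT :: "real \<Rightarrow> real \<Rightarrow> real \<Rightarrow> real \<Rightarrow> real \<Rightarrow> L1 \<Rightarrow> real \<Rightarrow> complex" is fun_SAFT
proof -
  fix a b d p q :: real and f g assume "L1_rel f g"
  then have [measurable]: "f \<in> borel_measurable borel" "g \<in> borel_measurable borel"
    and eq: "AE x in lborel. f x = g x"
    by (auto simp: L1_rel_def dest: borel_measurable_integrable)
  show "fun_SAFT a b d p q f = fun_SAFT a b d p q g"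
    unfolding fun_SAFT_def
    by (intro ext arg_cong2[where f = times] refl integral_cong_AE) (use eq in auto)
qed

lemma norm_A_translation: "norm (A_translation a b s g t) = norm (g (t - s))"
proof -
  have "- (2 * of_real pi * \<i> * of_real a / of_real b * of_real (s * (t - s))) =
      \<i> * complex_of_real (- (2 * pi * a / b * (s * (t - s))))"
    by simp
  then show ?thesis
    unfolding A_translation_def norm_mult by (simp only: norm_exp_i_times mult_1)
qed

lemma fun_A_conv_integrable:
  assumes f: "integrable lborel f" and g: "integrable lborel g"
  shows "integrable lborel (fun_A_conv a b f g)"
proof -
  have [measurable]: "f \<in> borel_measurable borel" "g \<in> borel_measurable borel"
    using f g by (auto dest: borel_measurable_integrable)
  define F where "F = (\<lambda>(s, x). f s * A_translation a b s g x)"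
  have meas[measurable]: "F \<in> borel_measurable (lborel \<Otimes>\<^sub>M lborel)"
    unfolding F_def A_translation_def by measurable
  have shift: "integrable lborel (\<lambda>x. norm (g (x - s)))"
    "(\<integral>x. norm (g (x - s)) \<partial>lborel) = (\<integral>x. norm (g x) \<partial>lborel)" for s
    using lborel_integrable_real_affine[OF integrable_norm[OF g], of 1 "- s"]
      lborel_integral_real_affine[of 1 "\<lambda>x. norm (g x)" "- s"] by simp_all
  have "integrable (lborel \<Otimes>\<^sub>M lborel) F"
  proof (rule lborel_pair.Fubini_integrable[OF meas])
    show "integrable lborel (\<lambda>s. \<integral>x. norm (F (s, x)) \<partial>lborel)"
      using f by (simp add: F_def norm_mult norm_A_translation shift)
    have "integrable lborel (\<lambda>x. F (s, x))" for s
    proof (rule Bochner_Integration.integrable_bound)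
      show "integrable lborel (\<lambda>x. norm (f s) * norm (g (x - s)))"
        using shift by simp
    qed (simp_all add: F_def norm_mult norm_A_translation A_translation_def)
    then show "AE s in lborel. integrable lborel (\<lambda>x. F (s, x))"
      by simp
  qed
  then have "integrable lborel (\<lambda>x. \<integral>s. F (s, x) \<partial>lborel)"
    by (rule lborel_pair.integrable_snd[of "\<lambda>s x. F (s, x)", simplified])
  then show ?thesis
    unfolding fun_A_conv_def[abs_def] F_def by simp
qed

lift_definition A_conv :: "real \<Rightarrow> real \<Rightarrow> L1 \<Rightarrow> L1 \<Rightarrow> L1" is fun_A_conv
proof -
  fix a b :: real and f f' g g' assume "L1_rel f f'" "L1_rel g g'"
  then have int: "integrable lborel f" "integrable lborel f'" "integrable lborel g" "integrable lborel g'"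
    and f: "AE x in lborel. f x = f' x" and g: "AE x in lborel. g x = g' x"
    by (auto simp: L1_rel_def)
  then have [measurable]: "f \<in> borel_measurable borel" "f' \<in> borel_measurable borel"
    "g \<in> borel_measurable borel" "g' \<in> borel_measurable borel"
    by (auto dest: borel_measurable_integrable)
  have "fun_A_conv a b f g x = fun_A_conv a b f' g' x" for x
  proof -
    have "AE s in lborel. g (x + (- 1) * s) = g' (x + (- 1) * s)"
      by (rule AE_borel_affine[of "- 1" "\<lambda>y. g y = g' y"]) (use g in auto)
    with f have "AE s in lborel. f s * A_translation a b s g x = f' s * A_translation a b s g' x"
      by eventually_elim (simp add: A_translation_def)
    then show ?thesis
      unfolding fun_A_conv_def
      by (intro arg_cong2[where f = times] refl integral_cong_AE) (auto simp: A_translation_def)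
  qed
  then show "L1_rel (fun_A_conv a b f g) (fun_A_conv a b f' g')"
    using int by (auto simp: L1_rel_def intro: fun_A_conv_integrable)
qed

section \<open>The target space\<close>

text \<open>Bounded continuous functions carry the supremum norm.\<close>

definition C0 :: "(real \<Rightarrow>\<^sub>C complex) set" where
  "C0 = {u. (apply_bcontfun u \<longlongrightarrow> 0) at_infinity}"

context includes bcontfun.lifting
begin

lift_definition bcontfun_scaleC :: "complex \<Rightarrow> (real \<Rightarrow>\<^sub>C complex) \<Rightarrow> (real \<Rightarrow>\<^sub>C complex)"
  is "\<lambda>k u x. k * u x"
  by (auto simp: bcontfun_def intro!: continuous_intros
      dest: bounded_linear_image[OF _ bounded_linear_mult_right] simp: image_image)

lemma vector_space_bcontfun_scaleC: "vector_space bcontfun_scaleC"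
  by standard (transfer; auto simp: algebra_simps)+

end

interpretation bcontfun_complex: vector_space bcontfun_scaleC
  by (rule vector_space_bcontfun_scaleC)

end

theory Submission
  imports Defs
begin

text \<open>A multiplicative functional is automatically bounded, because \<open>L1\<close> is complete and the geometric
  series of an element of norm less than one converges. Multiplication by a chirp turns the twisted
  convolution into the ordinary one. For a nonzero multiplicative functional \<open>h\<close> of the ordinary
  convolution, \<open>(\<tau> f) \<star> g = f \<star> (\<tau> g)\<close> for translations \<open>\<tau>\<close> gives a bounded homomorphism \<open>\<theta>\<close> with
  \<open>h (\<tau>\<^sub>s f) = \<theta> s * h f\<close>. Hence \<open>I x = h (indicator of (0, x])\<close> is a Lipschitz solution of
  \<open>I (x + y) = I x + \<theta> x * I y\<close>. This forces \<open>\<theta>\<close> to be continuous, hence of the form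
  \<open>x \<mapsto> exp (- 2 \<pi> i \<omega> x)\<close>, and determines \<open>I\<close> up to a constant factor. The Fourier
  transform at \<open>\<omega>\<close> satisfies the same equation, and step functions are dense, so \<open>h\<close> is a multiple of it;
  multiplicativity makes the factor 1. The second part applies the first to
  \<open>f \<mapsto> cnj (eta \<omega>) * T f \<omega>\<close> for each \<open>\<omega>\<close>.\<close>

section \<open>Representatives of classes and dominated convergence in \<open>L1\<close>\<close>

lemma abs_rep_L1: "abs_L1 (rep_L1 f) = f"
  by (rule Quotient3_abs_rep[OF Quotient3_L1])

lemma integrable_rep_L1: "integrable lborel (rep_L1 f)"
  using Quotient3_rep_reflp[OF Quotient3_L1, of f] by (simp add: L1_rel_def)

lemma norm_abs_L1: "integrable lborel f \<Longrightarrow> norm (abs_L1 f) = (\<integral>x. norm (f x) \<partial>lborel)"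
  by (subst norm_L1.abs_eq) (simp_all add: L1_rel_def)

lemma scaleR_L1_eq_scaleC: "r *\<^sub>R f = L1_scaleC (of_real r) f"
  by transfer (simp add: L1_rel_def scaleR_conv_of_real)

lemma borel_measurable_of_integrable:
  "integrable lborel f \<Longrightarrow> f \<in> borel_measurable borel"
  by (auto dest: borel_measurable_integrable)

lemma integrable_translate:
  fixes f :: "real \<Rightarrow> 'a::{banach, second_countable_topology}"
  assumes "integrable lborel f"
  shows "integrable lborel (\<lambda>t. f (t - s))"
  using lborel_integrable_real_affine[OF assms, of 1 "- s"] by simp

lemma integral_translate:
  fixes f :: "real \<Rightarrow> 'a::{banach, second_countable_topology}"
  shows "(\<integral>t. f (t - s) \<partial>lborel) = (\<integral>t. f t \<partial>lborel)"
  using lborel_integral_real_affine[of 1 f "- s"] by simp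

text \<open>Dominated convergence applies to \<open>norm (s n x - F x)\<close>, which is at most
  \<open>w x + norm (F x)\<close>; its integral is the distance in \<open>L1\<close>.\<close>

lemma tendsto_abs_L1_dominated:
  fixes w :: "real \<Rightarrow> real"
  assumes F: "integrable lborel F" and s: "\<And>n. integrable lborel (s n)" and w: "integrable lborel w"
    and lim: "AE x in lborel. (\<lambda>n. s n x) \<longlonglongrightarrow> F x"
    and bound: "\<And>n. AE x in lborel. norm (s n x) \<le> w x"
  shows "(\<lambda>n. abs_L1 (s n)) \<longlonglongrightarrow> abs_L1 F"
proof -
  have [measurable]: "F \<in> borel_measurable borel" "s n \<in> borel_measurable borel" for n
    using F s by (simp_all add: borel_measurable_of_integrable)
  have "(\<lambda>n. \<integral>x. norm (s n x - F x) \<partial>lborel) \<longlonglongrightarrow> (\<integral>x. 0 \<partial>(lborel :: real measure))"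
  proof (rule integral_dominated_convergence)
    show "integrable lborel (\<lambda>x. w x + norm (F x))"
      using w F by simp
    show "AE x in lborel. (\<lambda>n. norm (s n x - F x)) \<longlonglongrightarrow> 0"
      using lim by eventually_elim (rule tendsto_norm_zero[OF LIM_zero])
    show "AE x in lborel. norm (norm (s n x - F x)) \<le> w x + norm (F x)" for n
      using bound[of n]
    proof eventually_elim
      case (elim x)
      then show ?case using norm_triangle_ineq4[of "s n x" "F x"] by simp
    qed
  qed auto
  moreover have "norm (abs_L1 (s n) - abs_L1 F) = (\<integral>x. norm (s n x - F x) \<partial>lborel)" for n
    using F s by (subst minus_L1.abs_eq) (simp_all add: L1_rel_def norm_abs_L1)
  ultimately have "(\<lambda>n. norm (abs_L1 (s n) - abs_L1 F)) \<longlonglongrightarrow> 0"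
    by simp
  then show ?thesis
    by (rule LIM_zero_cancel[OF tendsto_norm_zero_cancel])
qed

section \<open>Convolution\<close>

text \<open>The phase in \<open>A_translation\<close> is unimodular, so Tonelli and translation
  invariance give absolute integrability on the plane. Fubini then makes almost every slice
  integrable, which additivity of the convolution in its second argument relies on.\<close>

lemma
  assumes f: "integrable lborel f" and g: "integrable lborel g"
  shows integrable_A_conv_integrand:
      "integrable (lborel \<Otimes>\<^sub>M lborel) (\<lambda>(s, x). f s * A_translation a b s g x)"
    and AE_integrable_A_conv_integrand:
      "AE x in lborel. integrable lborel (\<lambda>s. f s * A_translation a b s g x)"
proof -
  have [measurable]: "f \<in> borel_measurable borel" "g \<in> borel_measurable borel"
    using f g by (simp_all add: borel_measurable_of_integrable)
  note shift = integrable_translate[OF integrable_norm[OF g]] integral_translate[of "\<lambda>t. norm (g t)"]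
  show int: "integrable (lborel \<Otimes>\<^sub>M lborel) (\<lambda>(s, x). f s * A_translation a b s g x)"
  proof (rule lborel_pair.Fubini_integrable)
    show "(\<lambda>(s, x). f s * A_translation a b s g x) \<in> borel_measurable (lborel \<Otimes>\<^sub>M lborel)"
      unfolding A_translation_def by measurable
    show "integrable lborel (\<lambda>s. \<integral>x. norm (case (s, x) of (s, x) \<Rightarrow> f s * A_translation a b s g x) \<partial>lborel)"
      using f by (simp add: norm_mult norm_A_translation shift)
    have "integrable lborel (\<lambda>x. f s * A_translation a b s g x)" for s
      by (rule Bochner_Integration.integrable_bound[of _ "\<lambda>x. norm (f s) * norm (g (x - s))"])
        (simp_all add: shift norm_mult norm_A_translation A_translation_def)
    then show "AE s in lborel. integrable lborel (\<lambda>x. case (s, x) of (s, x) \<Rightarrow> f s * A_translation a b s g x)"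
      by simp
  qed
  show "AE x in lborel. integrable lborel (\<lambda>s. f s * A_translation a b s g x)"
    using lborel_pair.AE_integrable_snd[OF int] by simp
qed

text \<open>Young's inequality: once the phase is dropped, interchanging the integrals lets
  translation invariance split off the norm of \<open>g\<close>.\<close>

lemma integral_norm_fun_A_conv_le:
  assumes f: "integrable lborel f" and g: "integrable lborel g"
  shows "(\<integral>x. norm (fun_A_conv a b f g x) \<partial>lborel) \<le>
    (1 / sqrt \<bar>b\<bar>) * ((\<integral>x. norm (f x) \<partial>lborel) * (\<integral>x. norm (g x) \<partial>lborel))"
proof -
  have int: "integrable (lborel \<Otimes>\<^sub>M lborel) (\<lambda>(s, x). norm (f s) * norm (g (x - s)))"
    using integrable_norm[OF integrable_A_conv_integrand[OF f g, of a b]]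
    by (simp add: norm_mult norm_A_translation case_prod_unfold)
  have "(\<integral>x. norm (fun_A_conv a b f g x) \<partial>lborel) \<le>
      (\<integral>x. (1 / sqrt \<bar>b\<bar>) * (\<integral>s. norm (f s) * norm (g (x - s)) \<partial>lborel) \<partial>lborel)"
  proof (rule integral_mono)
    show "integrable lborel (\<lambda>x. norm (fun_A_conv a b f g x))"
      by (intro integrable_norm fun_A_conv_integrable f g)
    show "integrable lborel (\<lambda>x. (1 / sqrt \<bar>b\<bar>) * (\<integral>s. norm (f s) * norm (g (x - s)) \<partial>lborel))"
      using lborel_pair.integrable_snd[OF int] by simp
    fix x
    show "norm (fun_A_conv a b f g x) \<le> (1 / sqrt \<bar>b\<bar>) * (\<integral>s. norm (f s) * norm (g (x - s)) \<partial>lborel)"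
      unfolding fun_A_conv_def norm_mult
      using integral_norm_bound[of lborel "\<lambda>s. f s * A_translation a b s g x"]
      by (intro mult_mono) (simp_all add: norm_mult norm_A_translation norm_divide)
  qed
  also have "\<dots> = (1 / sqrt \<bar>b\<bar>) * (\<integral>x. (\<integral>s. norm (f s) * norm (g (x - s)) \<partial>lborel) \<partial>lborel)"
    by simp
  also have "(\<integral>x. (\<integral>s. norm (f s) * norm (g (x - s)) \<partial>lborel) \<partial>lborel) =
      (\<integral>s. (\<integral>x. norm (f s) * norm (g (x - s)) \<partial>lborel) \<partial>lborel)"
    by (rule lborel_pair.Fubini_integral[OF int])
  also have "\<dots> = (\<integral>s. norm (f s) * (\<integral>x. norm (g x) \<partial>lborel) \<partial>lborel)"
    by (simp add: integral_translate[of "\<lambda>t. norm (g t)"])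
  finally show ?thesis by simp
qed

lemma norm_A_conv_le: "norm (A_conv a b f g) \<le> (1 / sqrt \<bar>b\<bar>) * (norm f * norm g)"
  by transfer (simp only: L1_rel_def integral_norm_fun_A_conv_le)

text \<open>Additivity of the integral asks for integrable slices, so the identity is established
  almost everywhere before passing to classes.\<close>

lemma A_conv_add_right: "A_conv a b f (g + h) = A_conv a b f g + A_conv a b f h"
proof transfer
  fix a b :: real and f g h assume "L1_rel f f" "L1_rel g g" "L1_rel h h"
  then have f: "integrable lborel f" and g: "integrable lborel g" and h: "integrable lborel h"
    by (simp_all add: L1_rel_def)
  have "AE x in lborel. fun_A_conv a b f (\<lambda>x. g x + h x) x = fun_A_conv a b f g x + fun_A_conv a b f h x"
    using AE_integrable_A_conv_integrand[OF f g, of a b] AE_integrable_A_conv_integrand[OF f h, of a b]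
  proof eventually_elim
    case (elim x)
    have "A_translation a b s (\<lambda>x. g x + h x) x = A_translation a b s g x + A_translation a b s h x" for s
      by (simp add: A_translation_def distrib_left)
    with elim show ?case
      by (simp add: fun_A_conv_def distrib_left)
  qed
  then show "L1_rel (fun_A_conv a b f (\<lambda>x. g x + h x)) (\<lambda>x. fun_A_conv a b f g x + fun_A_conv a b f h x)"
    using f g h by (auto simp: L1_rel_def intro!: fun_A_conv_integrable)
qed

lemma A_conv_scaleC_right: "A_conv a b f (L1_scaleC k g) = L1_scaleC k (A_conv a b f g)"
proof transfer
  fix a b :: real and f k g assume "L1_rel f f" "L1_rel g g"
  moreover have "fun_A_conv a b f (\<lambda>x. k * g x) x = k * fun_A_conv a b f g x" for x
    unfolding fun_A_conv_def A_translation_def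
    by (simp add: mult.left_commute[of _ k])
  ultimately show "L1_rel (fun_A_conv a b f (\<lambda>x. k * g x)) (\<lambda>x. k * fun_A_conv a b f g x)"
    by (auto simp: L1_rel_def fun_A_conv_integrable)
qed

lemma bounded_linear_A_conv_right: "bounded_linear (A_conv a b f)"
  by (rule bounded_linear_intro[where K = "(1 / sqrt \<bar>b\<bar>) * norm f"])
    (use norm_A_conv_le[of a b f] in
      \<open>simp_all add: A_conv_add_right scaleR_L1_eq_scaleC A_conv_scaleC_right mult_ac\<close>)

section \<open>Automatic continuity\<close>

text \<open>Completeness, stated for absolutely convergent series. By Tonelli the norms of the
  representatives are summable almost everywhere; their sum is integrable and dominates the partial
  sums, which therefore converge in \<open>L1\<close> to the pointwise sum.\<close>

lemma summable_L1:
  fixes f :: "nat \<Rightarrow> L1"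
  assumes summable: "summable (\<lambda>n. norm (f n))"
  shows "summable f"
proof -
  define F where "F n = rep_L1 (f n)" for n
  have F[simp]: "integrable lborel (F n)" and [simp]: "abs_L1 (F n) = f n" for n
    by (simp_all add: F_def integrable_rep_L1 abs_rep_L1)
  have [measurable]: "F n \<in> borel_measurable borel" for n
    by (simp add: borel_measurable_of_integrable)
  have norm_f: "norm (f n) = (\<integral>x. norm (F n x) \<partial>lborel)" for n
    using norm_abs_L1[of "F n"] by simp
  have sumF: "summable (\<lambda>n. \<integral>x. norm (F n x) \<partial>lborel)"
    using summable by (simp add: norm_f)
  have "(\<integral>\<^sup>+x. (\<Sum>n. ennreal (norm (F n x))) \<partial>lborel) = (\<Sum>n. \<integral>\<^sup>+x. norm (F n x) \<partial>lborel)"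
    by (rule nn_integral_suminf) simp
  also have "\<dots> = (\<Sum>n. ennreal (\<integral>x. norm (F n x) \<partial>lborel))"
    by (simp add: nn_integral_eq_integral)
  also have "\<dots> \<noteq> \<infinity>"
    using sumF by (simp add: ennreal_suminf_neq_top)
  finally have "AE x in lborel. (\<Sum>n. ennreal (norm (F n x))) \<noteq> \<infinity>"
    by (intro nn_integral_PInf_AE) auto
  then have AE_sum: "AE x in lborel. summable (\<lambda>n. norm (F n x))"
    by eventually_elim (simp add: summable_suminf_not_top)
  define G where "G x = (\<Sum>n. F n x)" for x
  have G[simp]: "integrable lborel G"
    unfolding G_def by (rule integrable_suminf[OF F AE_sum sumF])
  then have [measurable]: "G \<in> borel_measurable borel"
    by (simp add: borel_measurable_of_integrable)
  have partial: "(\<Sum>n<N. f n) = abs_L1 (\<lambda>x. \<Sum>n<N. F n x)" for N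
  proof (induction N)
    case (Suc N)
    have "abs_L1 (\<lambda>x. \<Sum>n<Suc N. F n x) = abs_L1 (\<lambda>x. (\<Sum>n<N. F n x)) + abs_L1 (F N)"
      by (subst plus_L1.abs_eq) (simp_all add: L1_rel_def)
    then show ?case using Suc by simp
  qed (simp add: zero_L1_def)
  have "(\<lambda>N. abs_L1 (\<lambda>x. \<Sum>n<N. F n x)) \<longlonglongrightarrow> abs_L1 G"
  proof (rule tendsto_abs_L1_dominated)
    show "integrable lborel (\<lambda>x. \<Sum>n. norm (F n x))"
      by (intro integrable_suminf) (use AE_sum sumF in auto)
    show "AE x in lborel. (\<lambda>N. \<Sum>n<N. F n x) \<longlonglongrightarrow> G x"
      using AE_sum unfolding G_def by eventually_elim (rule summable_LIMSEQ[OF summable_norm_cancel])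
    show "AE x in lborel. norm (\<Sum>n<N. F n x) \<le> (\<Sum>n. norm (F n x))" for N
      using AE_sum
    proof eventually_elim
      case (elim x)
      have "norm (\<Sum>n<N. F n x) \<le> (\<Sum>n<N. norm (F n x))"
        by (rule norm_sum)
      also have "\<dots> \<le> (\<Sum>n. norm (F n x))"
        by (rule sum_le_suminf[OF elim]) auto
      finally show ?case .
    qed
  qed auto
  then have "f sums abs_L1 G"
    by (simp add: sums_def partial)
  then show ?thesis by (rule sums_summable)
qed

text \<open>If \<open>norm f < norm (h f)\<close>, scale to \<open>h g = 1\<close> and \<open>norm g < 1\<close>; the series \<open>s\<close> of the powers
  of \<open>g\<close> satisfies \<open>s = g + g \<star> s\<close>, so \<open>h s = 1 + h s\<close>.\<close>

lemma multiplicative_functional_bounded: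
  assumes lin: "Vector_Spaces.linear L1_scaleC (*) h"
    and mult: "\<And>f g. h (A_conv 0 1 f g) = h f * (h g :: complex)"
  shows "norm (h f) \<le> norm f"
proof (rule ccontr)
  interpret h: Vector_Spaces.linear L1_scaleC "(*)" h by (rule lin)
  assume "\<not> norm (h f) \<le> norm f"
  then have less: "norm f < norm (h f)" by simp
  then have nz: "h f \<noteq> 0"
    using norm_ge_zero[of f] by (auto simp del: norm_ge_zero)
  define g where "g = L1_scaleC (1 / h f) f"
  have hg: "h g = 1" using nz by (simp add: g_def h.scale)
  have ng: "norm g < 1"
  proof -
    have "norm g = norm f / norm (h f)"
      by (simp add: g_def norm_L1_scaleC norm_divide)
    with less nz show ?thesis by (simp add: divide_less_eq)
  qed
  interpret g: bounded_linear "A_conv 0 1 g" by (rule bounded_linear_A_conv_right)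
  \<comment> \<open>The convolution algebra has no unit, so the powers start at \<open>g\<close>
    itself: \<open>u n\<close> has exponent \<open>Suc n\<close>.\<close>
  define u where "u n = (A_conv 0 1 g ^^ n) g" for n
  have u0: "u 0 = g" and uS: "u (Suc n) = A_conv 0 1 g (u n)" for n by (simp_all add: u_def)
  have "norm (u n) \<le> norm g ^ Suc n" for n
  proof (induction n)
    case (Suc n)
    have "norm (u (Suc n)) \<le> norm g * norm (u n)"
      unfolding uS using norm_A_conv_le[of 0 1 g "u n"] by simp
    also have "\<dots> \<le> norm g * norm g ^ Suc n"
      by (rule mult_left_mono[OF Suc]) simp
    finally show ?case by simp
  qed (simp add: u0)
  moreover have "summable (\<lambda>n. norm g ^ Suc n)"
    using ng by (simp add: summable_mult summable_geometric)
  ultimately have "summable (\<lambda>n. norm (u n))"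
    by (intro summable_comparison_test'[of "\<lambda>n. norm g ^ Suc n" 0 "\<lambda>n. norm (u n)"]) simp_all
  then have sm: "summable u" by (rule summable_L1)
  have "suminf u = u 0 + (\<Sum>n. u (Suc n))"
    using suminf_split_head[OF sm] by simp
  also have "\<dots> = g + A_conv 0 1 g (suminf u)"
    by (simp add: u0 uS g.suminf[OF sm])
  finally have "h (suminf u) = h (g + A_conv 0 1 g (suminf u))" by (rule arg_cong)
  also have "\<dots> = 1 + h (suminf u)"
    by (simp only: h.add mult hg mult_1)
  finally show False by simp
qed

section \<open>Characters and cocycles of the real line\<close>

text \<open>The integral is a difference of two values of an antiderivative. Integrating a
  functional equation over such a window is what turns continuity of its solutions into
  differentiability.\<close>

lemma window_integral_differentiable:
  fixes g :: "real \<Rightarrow> complex"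
  assumes g: "continuous_on UNIV g" and \<delta>: "0 \<le> \<delta>"
  obtains D where "((\<lambda>x. integral {x..x+\<delta>} g) has_vector_derivative D) (at x0)"
proof -
  define K where "K u = integral {x0 - 1..u} g" for u
  have gc: "continuous_on S g" for S
    using g continuous_on_subset by blast
  have K: "(K has_vector_derivative g u) (at u)" if "x0 - 1 < u" for u
  proof -
    have "(K has_vector_derivative g u) (at u within {x0 - 1..u + 1})"
      unfolding K_def by (rule integral_has_vector_derivative[OF gc]) (use that in auto)
    moreover have "at u within {x0 - 1..u + 1} = at u"
      by (rule at_within_interior) (use that in \<open>auto simp: interior_atLeastAtMost_real\<close>)
    ultimately show ?thesis by simp
  qed
  have "((\<lambda>x. K (x + \<delta>) - K x) has_vector_derivative g (x0 + \<delta>) - g x0) (at x0)"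
  proof (rule has_vector_derivative_diff)
    have "(K \<circ> (\<lambda>x. x + \<delta>) has_vector_derivative 1 *\<^sub>R g (x0 + \<delta>)) (at x0)"
      by (rule vector_diff_chain_at) (use \<delta> in \<open>auto intro!: derivative_eq_intros K\<close>)
    then show "((\<lambda>x. K (x + \<delta>)) has_vector_derivative g (x0 + \<delta>)) (at x0)"
      by (simp add: o_def)
    show "(K has_vector_derivative g x0) (at x0)" by (rule K) simp
  qed
  then have "((\<lambda>x. integral {x..x+\<delta>} g) has_vector_derivative g (x0 + \<delta>) - g x0) (at x0)"
  proof (rule has_vector_derivative_transform_within_open[where S = "{x0 - 1<..}"])
    fix x assume "x \<in> {x0 - 1<..}"
    then show "K (x + \<delta>) - K x = integral {x..x+\<delta>} g"
      using Henstock_Kurzweil_Integration.integral_combine[of "x0 - 1" x "x + \<delta>" g] \<delta>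
      by (simp add: K_def integrable_continuous_real gc algebra_simps)
  qed auto
  then show thesis by (rule that)
qed

lemma integral_translate_Icc:
  fixes g :: "real \<Rightarrow> complex"
  shows "integral {x..x+\<delta>} g = integral {0..\<delta>} (\<lambda>y. g (x + y))"
  using integral_shift_Icc_real[of 0 \<delta> g x] by (simp add: add.commute o_def)

lemma zero_vector_derivative_constant:
  fixes f :: "real \<Rightarrow> 'a::real_normed_vector"
  assumes "\<And>x. (f has_vector_derivative 0) (at x)"
  shows "f x = f y"
  using has_derivative_zero_unique[of UNIV f] assms
  by (auto simp: has_vector_derivative_def)

lemma has_vector_derivative_translate:
  fixes f :: "real \<Rightarrow> 'a::real_normed_vector"
  assumes "(f has_vector_derivative D) (at 0)"
  shows "((\<lambda>u. f (u - x)) has_vector_derivative D) (at x)"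
proof -
  have "(f \<circ> (\<lambda>u. u - x) has_vector_derivative 1 *\<^sub>R D) (at x)"
    by (rule vector_diff_chain_at) (use assms in \<open>auto intro!: derivative_eq_intros\<close>)
  then show ?thesis by (simp add: o_def)
qed

text \<open>Integrating \<open>\<theta> (x + y) = \<theta> x * \<theta> y\<close> over
  \<open>y\<close> writes \<open>\<theta>\<close> as a window integral divided by a constant, so it
  is differentiable with derivative \<open>\<theta> x * D\<close>. Boundedness makes
  \<open>D\<close> purely imaginary.\<close>

lemma bounded_continuous_character:
  fixes \<theta> :: "real \<Rightarrow> complex"
  assumes cont: "continuous_on UNIV \<theta>"
    and hom: "\<And>x y. \<theta> (x + y) = \<theta> x * \<theta> y" and one: "\<theta> 0 = 1"
    and bounded: "\<And>x. norm (\<theta> x) \<le> M"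
  obtains \<omega> where "\<And>x. \<theta> x = cis (- 2 * pi * \<omega> * x)"
proof -
  \<comment> \<open>Some window has a nonzero integral: otherwise the derivative of the integral at
    0, which is \<open>\<theta> 0 = 1\<close>, would vanish.\<close>
  have "\<exists>\<delta>\<in>{0..1}. integral {0..\<delta>} \<theta> \<noteq> 0"
  proof (rule ccontr)
    assume "\<not> (\<exists>\<delta>\<in>{0..1}. integral {0..\<delta>} \<theta> \<noteq> 0)"
    then have z: "integral {0..\<delta>} \<theta> = 0" if "\<delta> \<in> {0..1}" for \<delta> using that by blast
    have "((\<lambda>u. integral {0..u} \<theta>) has_vector_derivative \<theta> 0) (at 0 within {0..1})"
      by (rule integral_has_vector_derivative) (use cont continuous_on_subset in auto)
    then have "((\<lambda>u. 0) has_vector_derivative \<theta> 0) (at 0 within {0..1})"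
      by (rule has_vector_derivative_transform[rotated 2]) (simp_all add: z)
    then have "\<theta> 0 = 0"
      using vector_derivative_unique_within_closed_interval[of 0 1 0 "\<lambda>_. 0" "\<theta> 0" 0] by simp
    with one show False by simp
  qed
  then obtain \<delta> where \<delta>: "0 \<le> \<delta>" "integral {0..\<delta>} \<theta> \<noteq> 0" by auto
  define m where "m = integral {0..\<delta>} \<theta>"
  have "\<theta> x = integral {x..x+\<delta>} \<theta> * inverse m" for x
    using \<delta>(2) by (simp add: integral_translate_Icc hom m_def)
  then have \<theta>_eq: "\<theta> = (\<lambda>x. integral {x..x+\<delta>} \<theta> * inverse m)" by blast
  obtain D' where "((\<lambda>x. integral {x..x+\<delta>} \<theta>) has_vector_derivative D') (at 0)"
    using window_integral_differentiable[OF cont \<delta>(1)] by blast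
  then have "((\<lambda>x. integral {x..x+\<delta>} \<theta> * inverse m) has_vector_derivative D' * inverse m) (at 0)"
    by (rule has_vector_derivative_mult_left)
  then obtain D where D0: "(\<theta> has_vector_derivative D) (at 0)"
    using \<theta>_eq by metis
  have D: "(\<theta> has_vector_derivative \<theta> x * D) (at x)" for x
    using has_vector_derivative_mult_right[OF has_vector_derivative_translate[OF D0, of x], of "\<theta> x"]
    by (simp add: hom[symmetric])
  \<comment> \<open>The quotient of \<open>\<theta>\<close> by the expected exponential is constant,
    equal to its value 1 at 0.\<close>
  have "((\<lambda>x. \<theta> x * exp (- (x *\<^sub>R D))) has_vector_derivative 0) (at x)" for x
    proof -
    have "((\<lambda>x. exp (x *\<^sub>R - D)) has_vector_derivative exp (x *\<^sub>R - D) * - D) (at x)"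
      by (rule exp_scaleR_has_vector_derivative_right)
    from has_vector_derivative_mult[OF D this] show ?thesis
      by (simp add: algebra_simps)
  qed
  from zero_vector_derivative_constant[OF this, of _ 0]
  have "\<theta> x * exp (- (x *\<^sub>R D)) = 1" for x by (simp add: one)
  then have exp: "\<theta> x = exp (x *\<^sub>R D)" for x
    by (simp add: exp_minus field_simps)
  have "Re D = 0"
  proof (rule ccontr)
    assume "Re D \<noteq> 0"
    \<comment> \<open>At \<open>M / Re D\<close> the real part of the exponent is \<open>M\<close>,
      and \<open>exp M \<ge> 1 + M\<close> exceeds the bound.\<close>
    then have "norm (\<theta> (M / Re D)) = exp M"
      by (simp add: exp norm_exp_eq_Re)
    then show False using bounded[of "M / Re D"] exp_ge_add_one_self[of M] by simp
  qed
  then have "\<theta> x = cis (- 2 * pi * (- Im D / (2 * pi)) * x)" for x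
    unfolding exp cis_conv_exp by (intro arg_cong[where f = exp]) (simp add: complex_eq_iff)
  then show thesis by (rule that)
qed

text \<open>Integrating the equation over \<open>y\<close> in \<open>{0..1}\<close> expresses
  \<open>I\<close> by a window integral and a multiple of \<open>\<theta>\<close>, both
  differentiable at 0. The equation then carries the derivative at 0 to every \<open>x\<close>,
  where it is multiplied by \<open>\<theta> x\<close>.\<close>

lemma cocycle_derivative:
  fixes \<theta> I :: "real \<Rightarrow> complex"
  assumes cont: "continuous_on UNIV I" and I: "\<And>x y. I (x + y) = I x + \<theta> x * I y"
    and \<theta>: "(\<theta> has_vector_derivative c) (at 0)"
  obtains k where "\<And>x. (I has_vector_derivative \<theta> x * k) (at x)"
proof -
  have int: "I integrable_on {0..1}"
    using cont continuous_on_subset by (blast intro: integrable_continuous_real)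
  have "integral {x..x+1} I = I x + \<theta> x * integral {0..1} I" for x
    using Henstock_Kurzweil_Integration.integral_add[OF integrable_const_ivl[of "I x" 0 1]
        integrable_on_mult_right[OF int, of "\<theta> x"]]
    by (simp add: integral_translate_Icc I)
  then have I_eq: "I = (\<lambda>x. integral {x..x+1} I - \<theta> x * integral {0..1} I)" by auto
  obtain D where "((\<lambda>x. integral {x..x+1} I) has_vector_derivative D) (at 0)"
    using window_integral_differentiable[OF cont zero_le_one] by blast
  then have "((\<lambda>x. integral {x..x+1} I - \<theta> x * integral {0..1} I) has_vector_derivative
      D - c * integral {0..1} I) (at 0)"
    by (intro has_vector_derivative_diff has_vector_derivative_mult_left \<theta>)
  then obtain k where k: "(I has_vector_derivative k) (at 0)"
    using I_eq by metis
  have "(I has_vector_derivative \<theta> x * k) (at x)" for x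
  proof -
    have "((\<lambda>u. I x + \<theta> x * I (u - x)) has_vector_derivative 0 + \<theta> x * k) (at x)"
      by (intro has_vector_derivative_add has_vector_derivative_const
          has_vector_derivative_mult_right has_vector_derivative_translate k)
    then show ?thesis by (simp add: I[symmetric])
  qed
  then show thesis by (rule that)
qed

text \<open>Both derivatives are constant multiples \<open>i\<close> and \<open>j\<close> of
  \<open>\<theta>\<close>, so \<open>j * I x - i * J x\<close> is constant, and it vanishes at 0.
  The point \<open>z\<close> ensures that \<open>j\<close> is nonzero.\<close>

lemma cocycles_proportional:
  fixes \<theta> I J :: "real \<Rightarrow> complex"
  assumes I: "continuous_on UNIV I" "\<And>x y. I (x + y) = I x + \<theta> x * I y"
    and J: "continuous_on UNIV J" "\<And>x y. J (x + y) = J x + \<theta> x * J y"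
    and \<theta>: "(\<theta> has_vector_derivative c) (at 0)" "\<theta> 0 \<noteq> 0" and nz: "J z \<noteq> 0"
  obtains k where "\<And>x. I x = k * J x"
proof -
  obtain i where i: "\<And>x. (I has_vector_derivative \<theta> x * i) (at x)"
    using cocycle_derivative[OF I \<theta>(1)] by blast
  obtain j where j: "\<And>x. (J has_vector_derivative \<theta> x * j) (at x)"
    using cocycle_derivative[OF J \<theta>(1)] by blast
  have I0: "I 0 = 0" and J0: "J 0 = 0"
    using I(2)[of 0 0] J(2)[of 0 0] \<theta>(2) by simp_all
  have "((\<lambda>x. j * I x - i * J x) has_vector_derivative 0) (at x)" for x
    by (rule derivative_eq_intros i j | simp)+
  from zero_vector_derivative_constant[OF this, of _ 0]
  have eq: "j * I x = i * J x" for x by (simp add: I0 J0)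
  have "j \<noteq> 0"
  proof
    assume "j = 0"
    then have "J z = J 0"
      using j by (intro zero_vector_derivative_constant) simp
    with nz J0 show False by simp
  qed
  with eq have "I x = i / j * J x" for x by (simp add: field_simps)
  then show thesis by (rule that)
qed

section \<open>Step functions\<close>

lift_definition translate_L1 :: "real \<Rightarrow> L1 \<Rightarrow> L1" is "\<lambda>s f t. f (t - s)"
proof -
  fix s :: real and f g assume fg: "L1_rel f g"
  then have [measurable]: "f \<in> borel_measurable borel" "g \<in> borel_measurable borel"
    by (simp_all add: L1_rel_def borel_measurable_of_integrable)
  have "AE t in lborel. f (- s + 1 * t) = g (- s + 1 * t)"
    by (rule AE_borel_affine[of 1 "\<lambda>y. f y = g y"]) (use fg in \<open>auto simp: L1_rel_def\<close>)
  with fg show "L1_rel (\<lambda>t. f (t - s)) (\<lambda>t. g (t - s))"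
    by (simp add: L1_rel_def integrable_translate)
qed

lemma norm_translate_L1: "norm (translate_L1 s f) = norm f"
  by transfer (use integral_translate[of "\<lambda>t. norm (_ t)"] in simp)

lemma translate_L1_add: "translate_L1 (s + t) f = translate_L1 s (translate_L1 t f)"
  by transfer (auto simp: L1_rel_def integrable_translate diff_diff_eq)

lemma translate_L1_0: "translate_L1 0 f = f"
  by transfer (simp add: L1_rel_def)

lemma integrable_complex_indicator:
  assumes "A \<in> sets M" "emeasure M A < \<infinity>"
  shows "integrable M (indicator A :: 'a \<Rightarrow> complex)"
proof -
  have "(\<lambda>x. complex_of_real (indicator A x)) = indicator A"
    by (auto simp: indicator_def)
  then show ?thesis
    using integrable_of_real[OF integrable_real_indicator[OF assms], where 'a = complex] by simp
qed

lemma emeasure_lborel_Ioc_finite: "emeasure lborel {a<..b::real} < \<infinity>"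
  by (cases "a \<le> b") auto

lemma integrable_step: "integrable lborel (\<lambda>t::real. indicator {0<..x} t - indicator {x<..0} t :: complex)"
  by (intro Bochner_Integration.integrable_diff integrable_complex_indicator emeasure_lborel_Ioc_finite) auto

text \<open>The oriented indicator of the interval from 0 to \<open>x\<close>, negative for negative
  \<open>x\<close>. The orientation and the half-open ends make the cocycle identity
  \<open>step_L1_add\<close> hold pointwise for all real arguments.\<close>

lift_definition step_L1 :: "real \<Rightarrow> L1" is "\<lambda>x t. indicator {0<..x} t - indicator {x<..0} t"
  by (simp add: L1_rel_def integrable_step)

lemma step_L1_add: "step_L1 (x + y) = step_L1 x + translate_L1 x (step_L1 y)"
proof transfer
  fix x y :: real
  have "indicator {0<..x + y} t - indicator {x + y<..0} t = (indicator {0<..x} t - indicator {x<..0} t +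
      (indicator {0<..y} (t - x) - indicator {y<..0} (t - x)) :: complex)" for t
    by (auto simp: indicator_def)
  then show "L1_rel (\<lambda>t. indicator {0<..x + y} t - indicator {x + y<..0} t)
      (\<lambda>t. indicator {0<..x} t - indicator {x<..0} t + (indicator {0<..y} (t - x) - indicator {y<..0} (t - x)))"
    using integrable_step[of "x + y"] by (simp add: L1_rel_def)
qed

lemma norm_step_L1: "norm (step_L1 x) = \<bar>x\<bar>"
proof transfer
  fix x :: real
  have "norm (indicator {0<..x} t - indicator {x<..0} t :: complex) = indicator {0<..x} t + indicator {x<..0} t" for t
    by (auto simp: indicator_def)
  then show "(\<integral>t. norm (indicator {0<..x} t - indicator {x<..0} t :: complex) \<partial>lborel) = \<bar>x\<bar>"
    by (cases "0 \<le> x") (simp_all add: measure_def)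
qed

text \<open>\<open>step_L1\<close> is an isometry, because the difference of two steps is a
  translate of the step of the difference.\<close>

lemma continuous_on_step_L1: "continuous_on UNIV step_L1"
proof -
  have "dist (step_L1 x) (step_L1 y) = dist x y" for x y
    using step_L1_add[of y "x - y"] by (simp add: dist_norm norm_translate_L1 norm_step_L1)
  then show ?thesis
    by (auto simp: continuous_on_iff)
qed

section \<open>Functionals vanishing on step functions\<close>

lemma abs_L1_indicator_Ioc:
  assumes "a \<le> b"
  shows "abs_L1 (indicator {a<..b}) = step_L1 b - step_L1 a"
proof -
  have "indicator {a<..b} = (\<lambda>t. indicator {0<..b} t - indicator {b<..0} t -
      (indicator {0<..a} t - indicator {a<..0} t) :: complex)"
    using assms by (intro ext) (auto split: split_indicator)
  then show ?thesis
    unfolding step_L1.abs_eq by (subst minus_L1.abs_eq) (simp_all add: L1_rel_def integrable_step)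
qed

text \<open>The Borel sets whose trace on a bounded interval has its indicator in the kernel of \<open>D\<close> form a
  Dynkin system containing the half-open intervals.\<close>

lemma functional_eq_0_if_steps:
  fixes D :: "L1 \<Rightarrow> complex"
  assumes D: "bounded_linear D" and scale: "\<And>k f. D (L1_scaleC k f) = k * D f"
    and steps: "\<And>x. D (step_L1 x) = 0"
  shows "D f = 0"
proof -
  interpret D: bounded_linear D by (rule D)
  \<comment> \<open>The kernel of \<open>D\<close> is closed under dominated limits. Countable
    unions, truncations and the final approximation by simple functions all rest on this.\<close>
  have dominated: "D (abs_L1 F) = 0"
    if "integrable lborel F" "\<And>n. integrable lborel (s n)" "integrable lborel (w :: real \<Rightarrow> real)"
      "\<And>x. (\<lambda>n. s n x) \<longlonglongrightarrow> F x" "\<And>n x. norm (s n x) \<le> w x" "\<And>n. D (abs_L1 (s n)) = 0"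
    for F s w
  proof -
    have "(\<lambda>n. abs_L1 (s n)) \<longlonglongrightarrow> abs_L1 F"
      by (rule tendsto_abs_L1_dominated[where w = w]) (use that in auto)
    from D.tendsto[OF this] that(6) show ?thesis
      by (simp add: LIMSEQ_const_iff)
  qed
  have zero: "D (abs_L1 (\<lambda>_. 0)) = 0"
    using D.zero by (simp add: zero_L1_def)
  have Ioc: "D (abs_L1 (indicator {a<..b})) = 0" for a b
  proof (cases "a \<le> b")
    case True
    then show ?thesis by (simp add: abs_L1_indicator_Ioc D.diff steps)
  next
    case False
    then have "(indicator {a<..b} :: real \<Rightarrow> complex) = (\<lambda>_. 0)" by auto
    then show ?thesis by (simp add: zero)
  qed
  have int: "integrable lborel (indicator (A \<inter> {a<..b}) :: real \<Rightarrow> complex)" if "A \<in> sets borel" for A a b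
  proof -
    have "emeasure lborel (A \<inter> {a<..b}) \<le> emeasure lborel {a<..b}"
      by (rule emeasure_mono) auto
    also have "\<dots> < \<infinity>"
      by (rule emeasure_lborel_Ioc_finite)
    finally show ?thesis using that by (intro integrable_complex_indicator) auto
  qed
  have int_Ioc: "integrable lborel (indicator {a<..b} :: real \<Rightarrow> complex)" for a b
    using int[of UNIV a b] by simp
  \<comment> \<open>Intersecting with a bounded interval keeps the complements in the induction of
    finite measure.\<close>
  have bounded: "D (abs_L1 (indicator (A \<inter> {a<..b}))) = 0" if "A \<in> sets borel" for A a b
  proof -
    define G where "G = range (\<lambda>(a, b). {a<..b::real})"
    have borel: "sets borel = sigma_sets UNIV G"
      by (simp add: G_def borel_sigma_sets_Ioc)
    have "Int_stable G"
      unfolding Int_stable_def G_def by (force simp: image_iff)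
    moreover have "G \<subseteq> Pow UNIV" by simp
    moreover have "A \<in> sigma_sets UNIV G" using that borel by simp
    ultimately show ?thesis
    proof (induction A rule: sigma_sets_induct_disjoint)
      case (basic A)
      then obtain c d where "A = {c<..d}" by (auto simp: G_def)
      then have "A \<inter> {a<..b} = {max a c<..min b d}" by auto
      then show ?case by (simp add: Ioc)
    next
      case empty
      then show ?case by (simp add: zero)
    next
      case (compl A)
      have "indicator ((UNIV - A) \<inter> {a<..b}) = (\<lambda>x. indicator {a<..b} x -
          indicator (A \<inter> {a<..b}) x :: complex)"
        by (intro ext) (auto split: split_indicator)
      moreover have "abs_L1 \<dots> = abs_L1 (indicator {a<..b}) - abs_L1 (indicator (A \<inter> {a<..b}))"
        using compl(1) borel by (subst minus_L1.abs_eq) (simp_all add: L1_rel_def int int_Ioc)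
      ultimately have "abs_L1 (indicator ((UNIV - A) \<inter> {a<..b})) =
          abs_L1 (indicator {a<..b}) - abs_L1 (indicator (A \<inter> {a<..b}))"
        by simp
      then show ?case using compl(2) Ioc[of a b] by (simp only: D.diff diff_self)
    next
      case (union A)
      have A[measurable]: "A i \<in> sets borel" for i using union(2) borel by auto
      have fin: "D (abs_L1 (indicator ((\<Union>i<n. A i) \<inter> {a<..b}))) = 0" for n :: nat
      proof (induction n)
        case 0
        then show ?case by (simp add: zero)
      next
        case (Suc n)
        have disj: "A n \<inter> (\<Union>i<n. A i) = {}"
        proof -
          have "A n \<inter> A i = {}" if "i < n" for i
            using disjoint_family_onD[OF union(1), of n i] that by simp
          then show ?thesis by auto
        qed
        then have "indicator ((\<Union>i<Suc n. A i) \<inter> {a<..b}) = (\<lambda>x. indicator (A n \<inter> {a<..b}) x +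
            indicator ((\<Union>i<n. A i) \<inter> {a<..b}) x :: complex)"
          by (intro ext) (auto simp: lessThan_Suc split: split_indicator)
        moreover have "abs_L1 \<dots> = abs_L1 (indicator (A n \<inter> {a<..b})) + abs_L1 (indicator ((\<Union>i<n. A i) \<inter> {a<..b}))"
          by (subst plus_L1.abs_eq) (simp_all add: L1_rel_def int)
        ultimately have "abs_L1 (indicator ((\<Union>i<Suc n. A i) \<inter> {a<..b})) =
            abs_L1 (indicator (A n \<inter> {a<..b})) + abs_L1 (indicator ((\<Union>i<n. A i) \<inter> {a<..b}))"
          by (simp only:)
        then show ?case using Suc union(3)[of n] by (simp only: D.add add_0)
      qed
      show ?case
      proof (rule dominated[where s = "\<lambda>n. indicator ((\<Union>i<n. A i) \<inter> {a<..b})" and w = "indicator {a<..b}"])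
        show "(\<lambda>n. indicator ((\<Union>i<n. A i) \<inter> {a<..b}) x :: complex) \<longlonglongrightarrow> indicator ((\<Union>i. A i) \<inter> {a<..b}) x" for x
          unfolding indicator_inter_arith by (intro tendsto_intros LIMSEQ_indicator_UN)
      next
        show "integrable lborel (indicator {a<..b} :: real \<Rightarrow> real)"
          by (intro integrable_real_indicator emeasure_lborel_Ioc_finite) auto
      qed (auto simp: int fin split: split_indicator)
    qed
  qed
  \<comment> \<open>Truncations to growing intervals exhaust a set of finite measure, whose own
    indicator dominates them.\<close>
  have indicator: "D (abs_L1 (indicator A)) = 0" if A: "A \<in> sets borel" "emeasure lborel A < \<infinity>" for A
  proof (rule dominated[where s = "\<lambda>n. indicator (A \<inter> {- real n<..real n})" and w = "indicator A"])
    show "(\<lambda>n. indicator (A \<inter> {- real n<..real n}) x :: complex) \<longlonglongrightarrow> indicator A x" for x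
    proof (rule tendsto_eventually)
      obtain N :: nat where "\<bar>x\<bar> < real N" using reals_Archimedean2 by blast
      then show "\<forall>\<^sub>F n in sequentially. indicator (A \<inter> {- real n<..real n}) x = (indicator A x :: complex)"
        by (intro eventually_sequentiallyI[of N]) (auto split: split_indicator)
    qed
  qed (use A in \<open>auto simp: bounded int integrable_complex_indicator split: split_indicator\<close>)
  have "D (abs_L1 F) = 0" if "integrable lborel F" for F
    using that
  proof (induction F rule: integrable_induct)
    case (base A c)
    have "abs_L1 (\<lambda>x. indicator A x *\<^sub>R c) = L1_scaleC c (abs_L1 (indicator A))"
    proof -
      have "(\<lambda>x. indicator A x *\<^sub>R c) = (\<lambda>x. c * indicator A x)"
        by (intro ext) (simp split: split_indicator)
      then show ?thesis
        using base by (subst L1_scaleC.abs_eq) (simp_all add: L1_rel_def integrable_complex_indicator)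
    qed
    then show ?case using base by (simp add: scale indicator)
  next
    case (add F G)
    then show ?case
      by (subst plus_L1.abs_eq[symmetric]) (simp_all add: L1_rel_def D.add)
  next
    case (lim F s)
    \<comment> \<open>The factor 2 is the bound that \<open>integrable_induct\<close> supplies for
      its approximating sequence.\<close>
    show ?case
      by (rule dominated[where s = s and w = "\<lambda>x. 2 * norm (F x)"]) (use lim in auto)
  qed
  from this[OF integrable_rep_L1[of f]] show ?thesis by (simp add: abs_rep_L1)
qed

section \<open>Characters of the convolution algebra\<close>

text \<open>The parameters \<open>0 1 0 0 0\<close> single out the ordinary Fourier transform, just
  as \<open>0 1\<close> in \<open>A_conv\<close> gives the ordinary convolution.\<close>

lemma fun_fourier_eq: "fun_SAFT 0 1 0 0 0 f \<omega> = (\<integral>t. f t * cis (- 2 * pi * \<omega> * t) \<partial>lborel)"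
proof -
  have "exp (of_real pi * \<i> / of_real 1 * of_real (0 * t\<^sup>2 + 2 * 0 * t - 2 * \<omega> * t + 2 * (1 * 0 - 0 * 0) * \<omega> + 0 * \<omega>\<^sup>2))
      = cis (- 2 * pi * \<omega> * t)" for t :: real
    by (simp add: cis_conv_exp mult_ac)
  then show ?thesis
    unfolding fun_SAFT_def by simp
qed

lemma fun_convolution_eq: "fun_A_conv 0 1 f g x = (\<integral>s. f s * g (x - s) \<partial>lborel)"
  by (simp add: fun_A_conv_def A_translation_def)

lemma integrable_mult_cis:
  assumes f: "integrable lborel f" and \<phi>[measurable]: "\<phi> \<in> borel_measurable borel"
  shows "integrable lborel (\<lambda>t. f t * cis (\<phi> t))"
proof -
  have [measurable]: "f \<in> borel_measurable borel"
    using f by (rule borel_measurable_of_integrable)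
  show ?thesis
    by (rule Bochner_Integration.integrable_bound[OF f]) (simp_all add: norm_mult cis_conv_exp)
qed

text \<open>A substitution moves the translation from one factor to the other. For a multiplicative
  \<open>h\<close> this means that \<open>h (translate_L1 s f) / h f\<close> is the same for all
  \<open>f\<close> with \<open>h f \<noteq> 0\<close>.\<close>

lemma convolution_translate: "A_conv 0 1 (translate_L1 s f) g = A_conv 0 1 f (translate_L1 s g)"
proof transfer
  fix s :: real and f g assume fg: "L1_rel f f" "L1_rel g g"
  have "fun_A_conv 0 1 (\<lambda>t. f (t - s)) g x = fun_A_conv 0 1 f (\<lambda>t. g (t - s)) x" for x
    using integral_translate[of "\<lambda>t. f t * g (x - t - s)" s]
    by (simp add: fun_convolution_eq algebra_simps)
  then show "L1_rel (fun_A_conv 0 1 (\<lambda>t. f (t - s)) g) (fun_A_conv 0 1 f (\<lambda>t. g (t - s)))"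
    using fg by (auto simp: L1_rel_def intro!: fun_A_conv_integrable integrable_translate)
qed

lemma fourier_add: "SAFT 0 1 0 0 0 (f + g) \<omega> = SAFT 0 1 0 0 0 f \<omega> + SAFT 0 1 0 0 0 g \<omega>"
  by transfer (simp add: L1_rel_def fun_fourier_eq distrib_right integrable_mult_cis)

lemma fourier_scaleC: "SAFT 0 1 0 0 0 (L1_scaleC k f) \<omega> = k * SAFT 0 1 0 0 0 f \<omega>"
  by transfer (simp add: L1_rel_def fun_fourier_eq mult.assoc)

lemma norm_fourier_le: "norm (SAFT 0 1 0 0 0 f \<omega>) \<le> norm f"
proof transfer
  fix f \<omega>
  show "norm (fun_SAFT 0 1 0 0 0 f \<omega>) \<le> (\<integral>x. norm (f x) \<partial>lborel)"
    unfolding fun_fourier_eq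
    using integral_norm_bound[of lborel "\<lambda>t. f t * cis (- 2 * pi * \<omega> * t)"]
    by (simp add: norm_mult)
qed

lemma bounded_linear_fourier: "bounded_linear (\<lambda>f. SAFT 0 1 0 0 0 f \<omega>)"
  by (rule bounded_linear_intro[where K = 1])
    (simp_all add: fourier_add scaleR_L1_eq_scaleC fourier_scaleC norm_fourier_le scaleR_conv_of_real)

lemma fourier_translate: "SAFT 0 1 0 0 0 (translate_L1 s f) \<omega> = cis (- 2 * pi * \<omega> * s) * SAFT 0 1 0 0 0 f \<omega>"
proof transfer
  fix s :: real and f \<omega>
  have "f (t - s) * cis (- 2 * pi * \<omega> * t) =
      cis (- 2 * pi * \<omega> * s) * (f (t - s) * cis (- 2 * pi * \<omega> * (t - s)))" for t
    by (subst mult.left_commute) (simp add: cis_mult right_diff_distrib)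
  then show "fun_SAFT 0 1 0 0 0 (\<lambda>t. f (t - s)) \<omega> = cis (- 2 * pi * \<omega> * s) * fun_SAFT 0 1 0 0 0 f \<omega>"
    using integral_translate[of "\<lambda>t. cis (- 2 * pi * \<omega> * s) * (f t * cis (- 2 * pi * \<omega> * t))" s]
    by (simp only: fun_fourier_eq integral_mult_right_zero)
qed

text \<open>Since \<open>e x = e s * e (x - s)\<close>, Fubini and a shift of the inner variable
  separate the double integral into a product. As \<open>e\<close> is unimodular, integrability is
  that of the convolution integrand.\<close>

lemma fourier_convolution:
  "SAFT 0 1 0 0 0 (A_conv 0 1 f g) \<omega> = SAFT 0 1 0 0 0 f \<omega> * SAFT 0 1 0 0 0 g \<omega>"
proof transfer
  fix f g \<omega> assume "L1_rel f f" "L1_rel g g"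
  then have f: "integrable lborel f" and g: "integrable lborel g"
    by (simp_all add: L1_rel_def)
  have [measurable]: "f \<in> borel_measurable borel" "g \<in> borel_measurable borel"
    using f g by (simp_all add: borel_measurable_of_integrable)
  define e where "e t = cis (- 2 * pi * \<omega> * t)" for t
  have e: "e (s + t) = e s * e t" for s t
    by (simp add: e_def cis_mult algebra_simps)
  have norm_e: "norm (e t) = 1" for t
    by (simp add: e_def)
  have [measurable]: "e \<in> borel_measurable borel"
    unfolding e_def[abs_def] cis_conv_exp by measurable
  have int: "integrable (lborel \<Otimes>\<^sub>M lborel) (\<lambda>(s, x). f s * g (x - s) * e x)"
    by (rule Bochner_Integration.integrable_bound[OF integrable_A_conv_integrand[OF f g, of 0 1]])
      (measurable, simp add: norm_mult norm_e A_translation_def case_prod_unfold)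
  have inner: "(\<integral>x. f s * g (x - s) * e x \<partial>lborel) = f s * e s * (\<integral>x. g x * e x \<partial>lborel)" for s
  proof -
    have eq: "f s * g (x - s) * e x = f s * e s * (g (x - s) * e (x - s))" for x
      using e[of s "x - s"] by simp
    have "(\<integral>x. f s * e s * (g (x - s) * e (x - s)) \<partial>lborel) = (\<integral>x. f s * e s * (g x * e x) \<partial>lborel)"
      by (rule integral_translate[of "\<lambda>x. f s * e s * (g x * e x)"])
    then show ?thesis by (simp only: eq integral_mult_right_zero)
  qed
  have "fun_SAFT 0 1 0 0 0 (fun_A_conv 0 1 f g) \<omega> = (\<integral>x. (\<integral>s. f s * g (x - s) * e x \<partial>lborel) \<partial>lborel)"
    by (simp add: fun_fourier_eq fun_convolution_eq e_def)
  also have "\<dots> = (\<integral>s. (\<integral>x. f s * g (x - s) * e x \<partial>lborel) \<partial>lborel)"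
    by (rule lborel_pair.Fubini_integral[OF int])
  also have "\<dots> = (\<integral>s. f s * e s \<partial>lborel) * (\<integral>x. g x * e x \<partial>lborel)"
    unfolding inner by simp
  finally show "fun_SAFT 0 1 0 0 0 (fun_A_conv 0 1 f g) \<omega> = fun_SAFT 0 1 0 0 0 f \<omega> * fun_SAFT 0 1 0 0 0 g \<omega>"
    by (simp add: fun_fourier_eq e_def)
qed

text \<open>Multiplying the indicator of \<open>{0<..1}\<close> by the conjugate of the kernel makes
  the transform at \<open>\<omega>\<close> the length 1 of the interval.\<close>

lemma fourier_nonzero: "\<exists>f. SAFT 0 1 0 0 0 f \<omega> \<noteq> 0"
proof -
  define f where "f t = indicator {0<..1} t * cis (2 * pi * \<omega> * t)" for t
  have int: "integrable lborel f"
    unfolding f_def by (intro integrable_mult_cis integrable_complex_indicator) auto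
  have "f t * cis (- 2 * pi * \<omega> * t) = complex_of_real (indicator {0<..1} t)" for t
    by (simp add: f_def mult.assoc cis_mult of_real_indicator)
  then have "SAFT 0 1 0 0 0 (abs_L1 f) \<omega> = complex_of_real (\<integral>t. indicator {0<..1::real} t \<partial>lborel)"
    using int by (subst SAFT.abs_eq) (simp_all add: L1_rel_def fun_fourier_eq del: of_real_indicator)
  also have "\<dots> = 1" by (simp add: measure_def)
  finally show ?thesis by (metis one_neq_zero)
qed

theorem convolution_character:
  assumes lin: "Vector_Spaces.linear L1_scaleC (*) h"
    and mult: "\<And>f g. h (A_conv 0 1 f g) = h f * (h g :: complex)"
    and nz: "h G \<noteq> 0"
  obtains \<omega> where "\<And>f. h f = SAFT 0 1 0 0 0 f \<omega>"
proof -
  interpret lin: Vector_Spaces.linear L1_scaleC "(*)" h by (rule lin)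
  have norm_h: "norm (h f) \<le> norm f" for f
    by (rule multiplicative_functional_bounded[OF lin mult])
  have bl: "bounded_linear h"
    by (rule bounded_linear_intro[where K = 1])
      (simp_all add: lin.add scaleR_L1_eq_scaleC lin.scale norm_h scaleR_conv_of_real)
  interpret h: bounded_linear h by (rule bl)
  define \<theta> where "\<theta> s = h (translate_L1 s G) / h G" for s
  \<comment> \<open>Applying \<open>h\<close> to \<open>convolution_translate\<close> with second
    factor \<open>G\<close> gives
    \<open>h (translate_L1 s f) * h G = h f * h (translate_L1 s G)\<close>.\<close>
  have translate: "h (translate_L1 s f) = \<theta> s * h f" for s f
    using arg_cong[OF convolution_translate[of s f G], of h] nz
    by (simp add: mult \<theta>_def field_simps)
  have \<theta>_0: "\<theta> 0 = 1"
    using nz by (simp add: \<theta>_def translate_L1_0)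
  have \<theta>_add: "\<theta> (s + t) = \<theta> s * \<theta> t" for s t
    using nz translate[of s "translate_L1 t G"] by (simp add: \<theta>_def translate_L1_add)
  have \<theta>_bounded: "norm (\<theta> s) \<le> norm G / norm (h G)" for s
    using norm_h[of "translate_L1 s G"] by (simp add: \<theta>_def norm_divide norm_translate_L1 divide_right_mono)
  define I where "I x = h (step_L1 x)" for x
  have I_add: "I (x + y) = I x + \<theta> x * I y" for x y
    by (simp add: I_def step_L1_add h.add translate)
  have I_cont: "continuous_on UNIV I"
    unfolding I_def by (rule h.continuous_on[OF continuous_on_step_L1])
  \<comment> \<open>If \<open>I\<close> vanished identically, \<open>h\<close> would vanish on all
    steps and hence on \<open>L1\<close>.\<close>
  obtain z where z: "I z \<noteq> 0"
    using functional_eq_0_if_steps[OF bl lin.scale] nz unfolding I_def by blast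
  \<comment> \<open>Solving the cocycle equation at \<open>y = z\<close> for
    \<open>\<theta> x\<close> passes the continuity of \<open>I\<close> on to
    \<open>\<theta>\<close>.\<close>
  have "\<theta> = (\<lambda>x. (I (x + z) - I x) / I z)"
    using z by (simp add: I_add)
  moreover have "continuous_on UNIV (\<lambda>x. (I (x + z) - I x) / I z)"
    using z by (intro continuous_intros continuous_on_compose2[OF I_cont] I_cont) auto
  ultimately have "continuous_on UNIV \<theta>" by simp
  then obtain \<omega> where \<omega>: "\<And>x. \<theta> x = cis (- 2 * pi * \<omega> * x)"
    using bounded_continuous_character[OF _ \<theta>_add \<theta>_0 \<theta>_bounded] by blast
  define F where "F f = SAFT 0 1 0 0 0 f \<omega>" for f
  have F: "bounded_linear F" and F_scale: "F (L1_scaleC k f) = k * F f" for k f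
    unfolding F_def by (rule bounded_linear_fourier fourier_scaleC)+
  interpret F: bounded_linear F by (rule F)
  have J_cont: "continuous_on UNIV (\<lambda>x. F (step_L1 x))"
    by (rule F.continuous_on[OF continuous_on_step_L1])
  have J_add: "F (step_L1 (x + y)) = F (step_L1 x) + \<theta> x * F (step_L1 y)" for x y
    by (simp add: step_L1_add F.add \<omega>) (simp add: F_def fourier_translate)
  obtain z' where z': "F (step_L1 z') \<noteq> 0"
    using functional_eq_0_if_steps[OF F F_scale] fourier_nonzero[of \<omega>] unfolding F_def by blast
  have "((\<lambda>x. exp (x *\<^sub>R (- 2 * pi * \<omega> * \<i>))) has_vector_derivative
      exp (0 *\<^sub>R (- 2 * pi * \<omega> * \<i>)) * (- 2 * pi * \<omega> * \<i>)) (at 0)"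
    by (rule exp_scaleR_has_vector_derivative_right)
  moreover have "\<theta> = (\<lambda>x. exp (x *\<^sub>R (- 2 * pi * \<omega> * \<i>)))"
    by (auto simp: \<omega> cis_conv_exp scaleR_conv_of_real mult_ac)
  ultimately have \<theta>': "(\<theta> has_vector_derivative - 2 * pi * \<omega> * \<i>) (at 0)"
    by simp
  \<comment> \<open>On steps, \<open>h\<close> and \<open>F\<close> are cocycles for the same
    \<open>\<theta>\<close>, hence proportional.\<close>
  obtain k where k: "\<And>x. I x = k * F (step_L1 x)"
    using cocycles_proportional[OF I_cont I_add J_cont J_add \<theta>' _ z'] \<theta>_0 by auto
  have h_eq: "h f = k * F f" for f
  proof -
    have "h f - k * F f = 0"
    proof (rule functional_eq_0_if_steps[of "\<lambda>f. h f - k * F f"])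
      show "bounded_linear (\<lambda>f. h f - k * F f)"
        by (intro bounded_linear_sub bl bounded_linear_const_mult F)
    qed (simp_all add: lin.scale F_scale algebra_simps k[unfolded I_def])
    then show ?thesis by simp
  qed
  \<comment> \<open>Both \<open>h\<close> and \<open>F\<close> are multiplicative, and
    \<open>h G \<noteq> 0\<close> makes \<open>k\<close> and \<open>F G\<close> nonzero, so both can
    be cancelled.\<close>
  have "k * (F G * F G) = k * F G * (k * F G)"
    using mult[of G G] unfolding h_eq by (simp add: F_def fourier_convolution)
  then have "k = 1"
    using nz h_eq[of G] by auto
  then show thesis using that h_eq by (simp add: F_def)
qed

section \<open>Reduction of the twisted convolution to the ordinary one\<close>

text \<open>An isometry with inverse \<open>chirp_L1 (- r)\<close>. For
  \<open>r = pi * a / b\<close> it carries the twisted convolution to the ordinary one, up to the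
  scalar \<open>1 / sqrt \<bar>b\<bar>\<close>.\<close>

lift_definition chirp_L1 :: "real \<Rightarrow> L1 \<Rightarrow> L1" is "\<lambda>r f t. f t * cis (r * t\<^sup>2)"
  by (auto simp: L1_rel_def intro!: integrable_mult_cis)

lemma chirp_L1_add: "chirp_L1 r (f + g) = chirp_L1 r f + chirp_L1 r g"
  by transfer (auto simp: L1_rel_def distrib_right intro!: Bochner_Integration.integrable_add integrable_mult_cis)

lemma chirp_L1_scaleC: "chirp_L1 r (L1_scaleC k f) = L1_scaleC k (chirp_L1 r f)"
  by transfer (auto simp: L1_rel_def mult.assoc intro!: integrable_mult_right integrable_mult_cis)

lemma chirp_L1_chirp_L1: "chirp_L1 r (chirp_L1 s f) = chirp_L1 (r + s) f"
  by transfer (auto simp: L1_rel_def mult.assoc cis_mult distrib_right add.commute intro!: integrable_mult_cis)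

lemma chirp_L1_0: "chirp_L1 0 f = f"
  by transfer (simp add: L1_rel_def)

text \<open>With \<open>x = s + (x - s)\<close>, the chirps of \<open>s\<close> and of \<open>x - s\<close> differ from the chirp of \<open>x\<close> by the
  factor in the twisted translation.\<close>

lemma A_conv_chirp_L1:
  "A_conv a b (chirp_L1 (- pi * a / b) f) (chirp_L1 (- pi * a / b) g) =
    L1_scaleC (of_real (1 / sqrt \<bar>b\<bar>)) (chirp_L1 (- pi * a / b) (A_conv 0 1 f g))"
proof transfer
  fix a b :: real and f g assume "L1_rel f f" "L1_rel g g"
  then have f: "integrable lborel f" and g: "integrable lborel g"
    by (simp_all add: L1_rel_def)
  define r where "r = - pi * a / b"
  have eq: "fun_A_conv a b (\<lambda>t. f t * cis (r * t\<^sup>2)) (\<lambda>t. g t * cis (r * t\<^sup>2)) x =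
      of_real (1 / sqrt \<bar>b\<bar>) * (fun_A_conv 0 1 f g x * cis (r * x\<^sup>2))" for x
  proof -
    have "f s * cis (r * s\<^sup>2) * A_translation a b s (\<lambda>t. g t * cis (r * t\<^sup>2)) x = f s * g (x - s) * cis (r * x\<^sup>2)" for s
    proof -
      have "exp (- (2 * of_real pi * \<i> * of_real a / of_real b * of_real (s * (x - s)))) = cis (2 * r * (s * (x - s)))"
        unfolding cis_conv_exp by (intro arg_cong[where f = exp]) (simp add: r_def)
      moreover have "cis (r * s\<^sup>2) * (cis (2 * r * (s * (x - s))) * cis (r * (x - s)\<^sup>2)) = cis (r * x\<^sup>2)"
        by (simp only: cis_mult) (simp add: power2_eq_square algebra_simps)
      ultimately show ?thesis
        by (simp add: A_translation_def mult_ac)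
    qed
    then show ?thesis
      by (simp only: fun_A_conv_def[of a b] fun_convolution_eq integral_mult_left_zero)
  qed
  have "integrable lborel (\<lambda>x. complex_of_real (1 / sqrt \<bar>b\<bar>) * (fun_A_conv 0 1 f g x * cis (r * x\<^sup>2)))"
    using f g by (intro integrable_mult_right integrable_mult_cis fun_A_conv_integrable) auto
  then show "L1_rel (fun_A_conv a b (\<lambda>t. f t * cis (- pi * a / b * t\<^sup>2)) (\<lambda>t. g t * cis (- pi * a / b * t\<^sup>2)))
      (\<lambda>x. of_real (1 / sqrt \<bar>b\<bar>) * (fun_A_conv 0 1 f g x * cis (- pi * a / b * x\<^sup>2)))"
    unfolding r_def[symmetric] eq[abs_def] by (simp add: L1_rel_def)
qed

section \<open>The special affine Fourier transform as a Fourier transform after a chirp\<close>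

lemma eta_eq_cis: "eta b d p q \<omega> = cis (pi / b * (d * \<omega>\<^sup>2 + 2 * (b * q - d * p) * \<omega>))"
  unfolding eta_def cis_conv_exp by (intro arg_cong[where f = exp]) simp

text \<open>\<open>eta\<close> carries exactly the terms of the exponent that involve
  \<open>\<omega>\<close> alone. There remain the chirp \<open>a * t\<^sup>2\<close> and the linear
  term \<open>2 * (p - \<omega>) * t\<close>, which is the Fourier kernel at
  \<open>(\<omega> - p) / b\<close>.\<close>

lemma cnj_eta_SAFT:
  assumes "b \<noteq> 0"
  shows "cnj (eta b d p q \<omega>) * SAFT a b d p q f \<omega> =
    of_real (1 / sqrt \<bar>b\<bar>) * SAFT 0 1 0 0 0 (chirp_L1 (pi * a / b) f) ((\<omega> - p) / b)"
proof transfer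
  fix b d p q \<omega> a :: real and f
  have "cnj (eta b d p q \<omega>) * (f t * exp (of_real pi * \<i> / of_real b *
        of_real (a * t\<^sup>2 + 2 * p * t - 2 * \<omega> * t + 2 * (b * q - d * p) * \<omega> + d * \<omega>\<^sup>2)))
      = f t * cis (pi * a / b * t\<^sup>2) * cis (- 2 * pi * ((\<omega> - p) / b) * t)" for t
  proof -
    have "exp (of_real pi * \<i> / of_real b *
        of_real (a * t\<^sup>2 + 2 * p * t - 2 * \<omega> * t + 2 * (b * q - d * p) * \<omega> + d * \<omega>\<^sup>2)) =
      cis (pi / b * (a * t\<^sup>2 + 2 * p * t - 2 * \<omega> * t + 2 * (b * q - d * p) * \<omega> + d * \<omega>\<^sup>2))"
      unfolding cis_conv_exp by (intro arg_cong[where f = exp]) simp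
    moreover have "cis (- (pi / b * (d * \<omega>\<^sup>2 + 2 * (b * q - d * p) * \<omega>))) *
        cis (pi / b * (a * t\<^sup>2 + 2 * p * t - 2 * \<omega> * t + 2 * (b * q - d * p) * \<omega> + d * \<omega>\<^sup>2)) =
        cis (pi * a / b * t\<^sup>2) * cis (- 2 * pi * ((\<omega> - p) / b) * t)"
      unfolding cis_mult by (intro arg_cong[where f = cis]) (simp add: algebra_simps add_divide_distrib diff_divide_distrib)
    ultimately show ?thesis
      by (simp add: eta_eq_cis cis_cnj mult_ac)
  qed
  then show "cnj (eta b d p q \<omega>) * fun_SAFT a b d p q f \<omega> =
    of_real (1 / sqrt \<bar>b\<bar>) * fun_SAFT 0 1 0 0 0 (\<lambda>t. f t * cis (pi * a / b * t\<^sup>2)) ((\<omega> - p) / b)"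
    unfolding fun_fourier_eq unfolding fun_SAFT_def
    by (simp only: mult.left_commute[of "cnj _"] integral_mult_right_zero[symmetric])
qed

section \<open>Multiplicative functionals and operators for the twisted convolution\<close>

theorem A_conv_character:
  assumes b: "b \<noteq> 0" and lin: "Vector_Spaces.linear L1_scaleC (*) h"
    and mult: "\<And>f g. h (A_conv a b f g) = h f * (h g :: complex)"
    and nz: "h G \<noteq> 0"
  shows "\<exists>\<omega>. \<forall>f. h f = cnj (eta b d p q \<omega>) * SAFT a b d p q f \<omega>"
proof -
  interpret h: Vector_Spaces.linear L1_scaleC "(*)" h by (rule lin)
  define r where "r = pi * a / b"
  define c where "c = complex_of_real (sqrt \<bar>b\<bar>)"
  have c: "c \<noteq> 0" "of_real (1 / sqrt \<bar>b\<bar>) = 1 / c" using b by (simp_all add: c_def)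
  \<comment> \<open>The factor \<open>c\<close> cancels the \<open>1 / sqrt \<bar>b\<bar>\<close> of
    the twisted convolution, so that \<open>h'\<close> is multiplicative for the ordinary
    one.\<close>
  define h' where "h' f = c * h (chirp_L1 (- r) f)" for f
  have h_eq: "h f = h' (chirp_L1 r f) / c" for f
    using c by (simp add: h'_def chirp_L1_chirp_L1 chirp_L1_0)
  have "Vector_Spaces.linear L1_scaleC (*) h'"
    by unfold_locales
      (simp_all add: h'_def chirp_L1_add h.add chirp_L1_scaleC h.scale algebra_simps)
  moreover have "h' (A_conv 0 1 f g) = h' f * h' g" for f g
    using arg_cong[OF A_conv_chirp_L1[of a b f g], of h] c
    by (simp add: h'_def mult h.scale r_def field_simps)
  moreover have "h' (chirp_L1 r G) \<noteq> 0"
    using nz h_eq[of G] by auto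
  ultimately obtain \<xi> where \<xi>: "\<And>f. h' f = SAFT 0 1 0 0 0 f \<xi>"
    using convolution_character by blast
  \<comment> \<open>\<open>b * \<xi> + p\<close> is the point whose frequency
    \<open>(\<omega> - p) / b\<close> in \<open>cnj_eta_SAFT\<close> is
    \<open>\<xi>\<close>.\<close>
  have "h f = cnj (eta b d p q (b * \<xi> + p)) * SAFT a b d p q f (b * \<xi> + p)" for f
    using b by (simp add: cnj_eta_SAFT h_eq \<xi> r_def c_def)
  then show ?thesis by blast
qed

text \<open>The first part asks for a nonzero \<open>h\<close>, because \<open>SAFT\<close> at a
  fixed frequency is never the zero functional. In the second part the zero functionals are absorbed
  by the indicator of \<open>E\<close>.\<close>

theorem theorem3p12:
  fixes a b c d p q :: real
  assumes "a * d - b * c = 1" and "b \<noteq> 0"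
  shows "(\<forall>h :: L1 \<Rightarrow> complex.
            Vector_Spaces.linear L1_scaleC (*) h \<and>
            (\<forall>f g. h (A_conv a b f g) = h f * h g) \<and>
            (\<exists>f. h f \<noteq> 0)
            \<longrightarrow> (\<exists>\<omega>\<^sub>0. \<forall>f. h f = cnj (eta b d p q \<omega>\<^sub>0) * SAFT a b d p q f \<omega>\<^sub>0)) \<and>
         (\<forall>T :: L1 \<Rightarrow> (real \<Rightarrow>\<^sub>C complex).
            (\<forall>f. T f \<in> C0) \<and>
            Vector_Spaces.linear L1_scaleC bcontfun_scaleC T \<and>
            continuous_on UNIV T \<and>
            (\<forall>f g \<omega>. T (A_conv a b f g) \<omega> = cnj (eta b d p q \<omega>) * T f \<omega> * T g \<omega>)
            \<longrightarrow> (\<exists>(E :: real set) (\<phi> :: real \<Rightarrow> real). \<forall>f \<omega>.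
                  T f \<omega> = indicator E \<omega> * (eta b d p q \<omega> * cnj (eta b d p q (\<phi> \<omega>))) *
                           SAFT a b d p q f (\<phi> \<omega>)))"
proof (intro conjI allI impI; elim conjE)
  fix h :: "L1 \<Rightarrow> complex"
  assume h: "Vector_Spaces.linear L1_scaleC (*) h" "\<forall>f g. h (A_conv a b f g) = h f * h g" "\<exists>f. h f \<noteq> 0"
  then obtain G where "h G \<noteq> 0" by blast
  with h show "\<exists>\<omega>\<^sub>0. \<forall>f. h f = cnj (eta b d p q \<omega>\<^sub>0) * SAFT a b d p q f \<omega>\<^sub>0"
    by (intro A_conv_character[OF assms(2)]) simp_all
next
  fix T :: "L1 \<Rightarrow> (real \<Rightarrow>\<^sub>C complex)"
  assume lin: "Vector_Spaces.linear L1_scaleC bcontfun_scaleC T"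
    and mult: "\<forall>f g \<omega>. T (A_conv a b f g) \<omega> = cnj (eta b d p q \<omega>) * T f \<omega> * T g \<omega>"
  interpret T: Vector_Spaces.linear L1_scaleC bcontfun_scaleC T by (rule lin)
  \<comment> \<open>Off \<open>E\<close> evaluation of \<open>T\<close> gives the zero functional,
    so a frequency has to be chosen only on \<open>E\<close>.\<close>
  define E where "E = {\<omega>. \<exists>f. T f \<omega> \<noteq> 0}"
  have eta: "eta b d p q \<omega> * cnj (eta b d p q \<omega>) = 1" for \<omega>
    by (simp add: eta_eq_cis cis_cnj cis_mult)
  have "\<exists>\<xi>. \<forall>f. cnj (eta b d p q \<omega>) * T f \<omega> = cnj (eta b d p q \<xi>) * SAFT a b d p q f \<xi>" if \<omega>: "\<omega> \<in> E" for \<omega>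
  proof -
    obtain G where G: "T G \<omega> \<noteq> 0" using \<omega> by (auto simp: E_def)
    have "apply_bcontfun (bcontfun_scaleC k u) \<omega> = k * u \<omega>" for k u
      including bcontfun.lifting by transfer simp
    then have "Vector_Spaces.linear L1_scaleC (*) (\<lambda>f. cnj (eta b d p q \<omega>) * T f \<omega>)"
      by unfold_locales (simp_all add: T.add T.scale plus_bcontfun.rep_eq algebra_simps)
    \<comment> \<open>One conjugate factor comes from the equation for \<open>T\<close>, the other
      from the functional itself; together they make it multiplicative.\<close>
    moreover have "cnj (eta b d p q \<omega>) * T (A_conv a b f g) \<omega> =
        (cnj (eta b d p q \<omega>) * T f \<omega>) * (cnj (eta b d p q \<omega>) * T g \<omega>)" for f g
      by (simp add: mult mult_ac)
    moreover have "cnj (eta b d p q \<omega>) * T G \<omega> \<noteq> 0"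
      using G eta[of \<omega>] by auto
    ultimately show ?thesis
      by (rule A_conv_character[OF assms(2)])
  qed
  then have "\<forall>\<omega>\<in>E. \<exists>\<xi>. \<forall>f. cnj (eta b d p q \<omega>) * T f \<omega> = cnj (eta b d p q \<xi>) * SAFT a b d p q f \<xi>"
    by blast
  from bchoice[OF this] obtain \<phi> where \<phi>: "\<And>\<omega> f. \<omega> \<in> E \<Longrightarrow>
      cnj (eta b d p q \<omega>) * T f \<omega> = cnj (eta b d p q (\<phi> \<omega>)) * SAFT a b d p q f (\<phi> \<omega>)"
    by blast
  have "T f \<omega> = indicator E \<omega> * (eta b d p q \<omega> * cnj (eta b d p q (\<phi> \<omega>))) * SAFT a b d p q f (\<phi> \<omega>)" for f \<omega>
  proof (cases "\<omega> \<in> E")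
    case True
    have "T f \<omega> = eta b d p q \<omega> * (cnj (eta b d p q \<omega>) * T f \<omega>)"
      using eta[of \<omega>] by (simp add: mult.assoc[symmetric])
    with True show ?thesis by (simp add: \<phi> mult.assoc)
  next
    case False
    then show ?thesis by (simp add: E_def)
  qed
  then show "\<exists>E \<phi>. \<forall>f \<omega>. T f \<omega> =
      indicator E \<omega> * (eta b d p q \<omega> * cnj (eta b d p q (\<phi> \<omega>))) * SAFT a b d p q f (\<phi> \<omega>)"
    by blast
qed

end
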